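(* The map $\mathrm{Pal}:F_2\to F_2$ is continuous for the profinite topology on $F_2$.
   Context: $F_2$ is the free group on $a,b$. $w\mapsto R_w$ is the group homomorphism $F_2\to\mathrm{Aut}(F_2)$ with $R_a(a)=a$, $R_a(b)=ba$, $R_b(a)=ab$, $R_b(b)=b$. The palindromization map $\mathrm{Pal}:F_2\to F_2$ is defined by $\mathrm{Pal}(w)=b^{-1}a^{-1}R_w(ab)$. The profinite topology on $F_2$ is the coarsest topology such that every group homomorphism from $F_2$ to a finite (discrete) group is continuous. *)

theory Defs
  imports
    "HOL-Analysis.Abstract_Topology"
    "HOL-Algebra.Bij"
begin

section \<open>Free groups as groups of reduced words\<close>

text \<open>The letter \<open>(x, True)\<close> stands for the generator \<open>x\<close> and \<open>(x, False)\<close> for its inverse.\<close>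

type_synonym 'g letter = "'g \<times> bool"

definition inv_letter :: "'g letter \<Rightarrow> 'g letter" where
  "inv_letter l = (fst l, \<not> snd l)"

definition reduced :: "'g letter list \<Rightarrow> bool" where
  "reduced w \<longleftrightarrow> successively (\<lambda>l m. m \<noteq> inv_letter l) w"

fun push_letter :: "'g letter \<Rightarrow> 'g letter list \<Rightarrow> 'g letter list" where
  "push_letter l [] = [l]"
| "push_letter l (m # w) = (if m = inv_letter l then w else l # m # w)"

definition reduce :: "'g letter list \<Rightarrow> 'g letter list" where
  "reduce w = foldr push_letter w []"

definition free_group :: "'g letter list monoid" where
  "free_group = \<lparr>carrier = {w. reduced w}, mult = \<lambda>u v. reduce (u @ v), one = []\<rparr>"

definition free_gen :: "'g \<Rightarrow> 'g letter list" where
  "free_gen x = [(x, True)]"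

lemma inv_letter_inv_letter [simp]: "inv_letter (inv_letter l) = l"
  by (simp add: inv_letter_def)

lemma inv_letter_neq [simp]: "inv_letter l \<noteq> l" "l \<noteq> inv_letter l"
  by (auto simp: inv_letter_def prod_eq_iff)

lemma reduced_Nil [simp]: "reduced []"
  by (simp add: reduced_def)

lemma reduced_single [simp]: "reduced [l]"
  by (simp add: reduced_def)

lemma reduced_Cons: "reduced (l # w) \<longleftrightarrow> reduced w \<and> (w = [] \<or> hd w \<noteq> inv_letter l)"
  by (auto simp: reduced_def successively_Cons)

lemma reduced_push: "reduced w \<Longrightarrow> reduced (push_letter l w)"
  by (cases w) (auto simp: reduced_Cons)

lemma reduced_foldr_push: "reduced w \<Longrightarrow> reduced (foldr push_letter u w)"
  by (induction u) (auto intro: reduced_push)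

lemma reduced_reduce [simp]: "reduced (reduce w)"
  by (simp add: reduce_def reduced_foldr_push)

lemma reduce_reduced: "reduced w \<Longrightarrow> reduce w = w"
proof (induction w)
  case (Cons l w)
  then have "reduce (l # w) = push_letter l w"
    by (simp add: reduce_def reduced_Cons)
  with Cons.prems show ?case by (cases w) (auto simp: reduced_Cons)
qed (simp add: reduce_def)

lemma push_push_inv: "reduced w \<Longrightarrow> push_letter l (push_letter (inv_letter l) w) = w"
  by (cases w; cases "tl w") (auto simp: reduced_Cons)

lemma foldr_push_push:
  "reduced w \<Longrightarrow> foldr push_letter (push_letter l u) w = push_letter l (foldr push_letter u w)"
  by (cases u) (auto simp: push_push_inv reduced_foldr_push)

lemma foldr_push_reduce:
  "reduced w \<Longrightarrow> foldr push_letter (reduce u) w = foldr push_letter u w"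
  by (induction u) (auto simp: reduce_def foldr_push_push)

lemma reduce_append: "reduce (u @ v) = foldr push_letter u (reduce v)"
  by (simp add: reduce_def)

lemma reduce_inv_word: "reduce (map inv_letter (rev w) @ w) = []"
proof (induction w)
  case (Cons l w)
  have "push_letter (inv_letter l) (push_letter l (reduce w)) = reduce w"
    using push_push_inv[of "reduce w" "inv_letter l"] by simp
  with Cons show ?case by (simp add: reduce_def)
qed (simp add: reduce_def)

lemma carrier_free_group [simp]: "w \<in> carrier free_group \<longleftrightarrow> reduced w"
  by (simp add: free_group_def)

lemma one_free_group [simp]: "\<one>\<^bsub>free_group\<^esub> = []"
  by (simp add: free_group_def)

lemma mult_free_group: "u \<otimes>\<^bsub>free_group\<^esub> v = reduce (u @ v)"
  by (simp add: free_group_def)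

theorem group_free_group: "group free_group"
proof (rule groupI)
  fix u v w :: "'a letter list"
  assume "u \<in> carrier free_group" "v \<in> carrier free_group" "w \<in> carrier free_group"
  then show "u \<otimes>\<^bsub>free_group\<^esub> v \<otimes>\<^bsub>free_group\<^esub> w = u \<otimes>\<^bsub>free_group\<^esub> (v \<otimes>\<^bsub>free_group\<^esub> w)"
    using foldr_push_reduce[of w "u @ v"]
    by (simp add: mult_free_group reduce_append reduce_reduced reduced_foldr_push)
next
  fix u :: "'a letter list"
  assume "u \<in> carrier free_group"
  then have "reduce (reduce (map inv_letter (rev u)) @ u) = []"
    by (simp add: reduce_append foldr_push_reduce flip: reduce_inv_word[of u])
  then show "\<exists>v\<in>carrier free_group. v \<otimes>\<^bsub>free_group\<^esub> u = \<one>\<^bsub>free_group\<^esub>"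
    by (intro bexI[of _ "reduce (map inv_letter (rev u))"]) (auto simp: mult_free_group)
qed (auto simp: mult_free_group reduce_reduced)

lemma reduced_free_gen [simp]: "reduced (free_gen x)"
  by (simp add: free_gen_def)

lemma inv_free_gen: "inv\<^bsub>free_group\<^esub> (free_gen x) = [(x, False)]"
proof (rule group.inv_equality[OF group_free_group])
  show "[(x, False)] \<otimes>\<^bsub>free_group\<^esub> free_gen x = \<one>\<^bsub>free_group\<^esub>"
    by (simp add: mult_free_group reduce_def free_gen_def inv_letter_def)
qed auto

text \<open>Universal property\<close>

definition free_lift :: "('h, 'm) monoid_scheme \<Rightarrow> ('g \<Rightarrow> 'h) \<Rightarrow> 'g letter list \<Rightarrow> 'h" where
  "free_lift H f w =
     foldr (\<lambda>(x, s) r. (if s then f x else inv\<^bsub>H\<^esub> f x) \<otimes>\<^bsub>H\<^esub> r) w \<one>\<^bsub>H\<^esub>"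

context group
begin

lemma free_lift_Nil [simp]: "free_lift G f [] = \<one>"
  by (simp add: free_lift_def)

lemma free_lift_Cons:
  "free_lift G f (l # w) = (if snd l then f (fst l) else inv f (fst l)) \<otimes> free_lift G f w"
  by (simp add: free_lift_def case_prod_beta)

lemma free_lift_closed:
  assumes "range f \<subseteq> carrier G"
  shows "free_lift G f w \<in> carrier G"
proof (induction w)
  case (Cons l w)
  have "f (fst l) \<in> carrier G" using assms by auto
  with Cons show ?case by (simp add: free_lift_Cons)
qed simp

lemma free_lift_push:
  assumes "range f \<subseteq> carrier G"
  shows "free_lift G f (push_letter l w) = free_lift G f (l # w)"
proof (cases w)
  case (Cons m v)
  have f: "f x \<in> carrier G" for x using assms by auto
  show ?thesis
  proof (cases "m = inv_letter l")
    case True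
    with Cons f show ?thesis
      by (auto simp: free_lift_Cons inv_letter_def free_lift_closed[OF assms] l_inv r_inv
            simp flip: m_assoc)
  qed (simp add: Cons)
qed simp

lemma free_lift_append:
  assumes "range f \<subseteq> carrier G"
  shows "free_lift G f (u @ v) = free_lift G f u \<otimes> free_lift G f v"
proof (induction u)
  case (Cons l u)
  have "f (fst l) \<in> carrier G" using assms by auto
  with Cons show ?case by (simp add: free_lift_Cons free_lift_closed[OF assms] m_assoc)
qed (simp add: free_lift_closed[OF assms])

lemma free_lift_reduce:
  assumes "range f \<subseteq> carrier G"
  shows "free_lift G f (reduce w) = free_lift G f w"
  by (induction w)
     (simp_all add: reduce_def free_lift_push[OF assms], simp add: free_lift_Cons)

lemma free_lift_hom:
  assumes "range f \<subseteq> carrier G"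
  shows "free_lift G f \<in> hom free_group G"
  by (rule homI)
     (simp_all add: free_lift_closed[OF assms] mult_free_group free_lift_reduce[OF assms]
        free_lift_append[OF assms])

lemma free_lift_gen:
  assumes "range f \<subseteq> carrier G"
  shows "free_lift G f (free_gen x) = f x"
proof -
  have "f x \<in> carrier G" using assms by auto
  then show ?thesis by (simp add: free_gen_def free_lift_Cons)
qed

lemma free_hom_eq:
  assumes h: "h \<in> hom free_group G" and k: "k \<in> hom free_group G"
    and gens: "\<And>x. h (free_gen x) = k (free_gen x)" and w: "reduced w"
  shows "h w = k w"
proof -
  interpret h: group_hom free_group G h
    using h by (simp add: group_hom_def group_hom_axioms_def group_free_group)
  interpret k: group_hom free_group G k
    using k by (simp add: group_hom_def group_hom_axioms_def group_free_group)
  show ?thesis using w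
  proof (induction w)
    case Nil
    then show ?case using h.hom_one k.hom_one by simp
  next
    case (Cons l w)
    have "h [l] = k [l]"
    proof (cases l)
      case (Pair x s)
      show ?thesis
      proof (cases s)
        case True
        with Pair gens[of x] show ?thesis by (simp add: free_gen_def)
      next
        case False
        have "h (inv\<^bsub>free_group\<^esub> (free_gen x)) = k (inv\<^bsub>free_group\<^esub> (free_gen x))"
          by (simp add: gens)
        with Pair False show ?thesis by (simp add: inv_free_gen)
      qed
    qed
    moreover have "[l] \<otimes>\<^bsub>free_group\<^esub> w = l # w"
      using reduce_reduced[OF Cons.prems] by (simp add: mult_free_group)
    moreover have "reduced w"
      using Cons.prems by (simp add: reduced_Cons)
    ultimately show ?case
      using Cons.IH h.hom_mult[of "[l]" w] k.hom_mult[of "[l]" w] by simp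
  qed
qed

end


section \<open>The free group on two generators and the palindromization map\<close>

datatype F2_gen = GenA | GenB

type_synonym F2_word = "F2_gen letter list"

abbreviation F2 :: "F2_word monoid" where "F2 \<equiv> free_group"
abbreviation gen_a :: F2_word where "gen_a \<equiv> free_gen GenA"
abbreviation gen_b :: F2_word where "gen_b \<equiv> free_gen GenB"

text \<open>
  Elements of \<^term>\<open>AutoGroup F2\<close> and the map itself are functions that are \<^const>\<open>undefined\<close>
  outside \<^term>\<open>carrier F2\<close>, which makes the description below determine the map as a HOL function.
  The product of \<^term>\<open>AutoGroup F2\<close> is composition, the right factor being applied first.
\<close>

definition is_R :: "(F2_word \<Rightarrow> F2_word \<Rightarrow> F2_word) \<Rightarrow> bool" where
  "is_R R \<longleftrightarrow>
     R \<in> hom F2 (AutoGroup F2) \<and> R \<in> extensional (carrier F2) \<and>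
     R gen_a gen_a = gen_a \<and> R gen_a gen_b = gen_b \<otimes>\<^bsub>F2\<^esub> gen_a \<and>
     R gen_b gen_a = gen_a \<otimes>\<^bsub>F2\<^esub> gen_b \<and> R gen_b gen_b = gen_b"

definition R_map :: "F2_word \<Rightarrow> F2_word \<Rightarrow> F2_word" where
  "R_map = (THE R. is_R R)"

definition Pal :: "F2_word \<Rightarrow> F2_word" where
  "Pal w = inv\<^bsub>F2\<^esub> gen_b \<otimes>\<^bsub>F2\<^esub> inv\<^bsub>F2\<^esub> gen_a \<otimes>\<^bsub>F2\<^esub> R_map w (gen_a \<otimes>\<^bsub>F2\<^esub> gen_b)"

lemma F2_hom_eq:
  assumes "group H" "h \<in> hom F2 H" "k \<in> hom F2 H"
    and "h gen_a = k gen_a" "h gen_b = k gen_b" "w \<in> carrier F2"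
  shows "h w = k w"
proof (rule group.free_hom_eq[OF assms(1-3)])
  show "h (free_gen x) = k (free_gen x)" for x
    using assms(4,5) by (cases x) auto
qed (use assms(6) in simp)

lemma F2_endo_auto:
  assumes h: "h \<in> hom F2 F2" and k: "k \<in> hom F2 F2"
    and hk: "h (k gen_a) = gen_a" "h (k gen_b) = gen_b"
    and kh: "k (h gen_a) = gen_a" "k (h gen_b) = gen_b"
  shows "restrict h (carrier F2) \<in> auto F2"
proof -
  have hh: "h w \<in> carrier F2" and kk: "k w \<in> carrier F2" if "w \<in> carrier F2" for w
    using that h k by (auto simp: hom_def)
  have id: "(\<lambda>w. w) \<in> hom F2 F2" by (rule homI) auto
  have comp: "(\<lambda>w. h (k w)) \<in> hom F2 F2" "(\<lambda>w. k (h w)) \<in> hom F2 F2"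
    using h k by (auto simp: hom_def Pi_iff)
  have "h (k w) = w" "k (h w) = w" if "w \<in> carrier F2" for w
    using F2_hom_eq[OF group_free_group comp(1) id] F2_hom_eq[OF group_free_group comp(2) id]
      that hk kh by auto
  then have "bij_betw h (carrier F2) (carrier F2)"
    using hh kk by (intro bij_betw_byWitness[where f' = k]) auto
  moreover have "restrict h (carrier F2) \<in> hom F2 F2"
    using h
    by (auto simp: hom_def Pi_iff mult_free_group)
  ultimately show ?thesis
    by (auto simp: auto_def Bij_def)
qed

definition R_gen :: "F2_gen \<Rightarrow> F2_word \<Rightarrow> F2_word" where
  "R_gen x = restrict (free_lift F2
     (case x of GenA \<Rightarrow> case_F2_gen gen_a (gen_b \<otimes>\<^bsub>F2\<^esub> gen_a)
              | GenB \<Rightarrow> case_F2_gen (gen_a \<otimes>\<^bsub>F2\<^esub> gen_b) gen_b)) (carrier F2)"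

lemma range_F2_gen: "range (case_F2_gen u v) \<subseteq> {u, v}"
  by (auto split: F2_gen.splits)

lemma R_gen_auto: "R_gen x \<in> auto F2"
proof (cases x)
  case GenA
  have r: "range (case_F2_gen gen_a (gen_b \<otimes>\<^bsub>F2\<^esub> gen_a)) \<subseteq> carrier F2"
          "range (case_F2_gen gen_a (gen_b \<otimes>\<^bsub>F2\<^esub> inv\<^bsub>F2\<^esub> gen_a)) \<subseteq> carrier F2"
    by (rule order.trans[OF range_F2_gen], simp add: mult_free_group)+
  show ?thesis
    unfolding GenA R_gen_def F2_gen.case
  proof (rule F2_endo_auto)
    show "free_lift F2 (case_F2_gen gen_a (gen_b \<otimes>\<^bsub>F2\<^esub> gen_a)) \<in> hom F2 F2"
         "free_lift F2 (case_F2_gen gen_a (gen_b \<otimes>\<^bsub>F2\<^esub> inv\<^bsub>F2\<^esub> gen_a)) \<in> hom F2 F2"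
      by (intro group.free_lift_hom group_free_group r)+
  qed (simp_all add: group.free_lift_gen[OF group_free_group r(1)]
         group.free_lift_gen[OF group_free_group r(2)] inv_free_gen mult_free_group reduce_def
         free_lift_def free_gen_def inv_letter_def inv_free_gen[unfolded free_gen_def])
next
  case GenB
  have r: "range (case_F2_gen (gen_a \<otimes>\<^bsub>F2\<^esub> gen_b) gen_b) \<subseteq> carrier F2"
          "range (case_F2_gen (gen_a \<otimes>\<^bsub>F2\<^esub> inv\<^bsub>F2\<^esub> gen_b) gen_b) \<subseteq> carrier F2"
    by (rule order.trans[OF range_F2_gen], simp add: mult_free_group)+
  show ?thesis
    unfolding GenB R_gen_def F2_gen.case
  proof (rule F2_endo_auto)
    show "free_lift F2 (case_F2_gen (gen_a \<otimes>\<^bsub>F2\<^esub> gen_b) gen_b) \<in> hom F2 F2"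
         "free_lift F2 (case_F2_gen (gen_a \<otimes>\<^bsub>F2\<^esub> inv\<^bsub>F2\<^esub> gen_b) gen_b) \<in> hom F2 F2"
      by (intro group.free_lift_hom group_free_group r)+
  qed (simp_all add: group.free_lift_gen[OF group_free_group r(1)]
         group.free_lift_gen[OF group_free_group r(2)] inv_free_gen mult_free_group reduce_def
         free_lift_def free_gen_def inv_letter_def inv_free_gen[unfolded free_gen_def])
qed

lemma carrier_AutoGroup: "carrier (AutoGroup G) = auto G"
  by (simp add: AutoGroup_def)

lemma R_gen_values:
  "R_gen GenA gen_a = gen_a" "R_gen GenA gen_b = gen_b \<otimes>\<^bsub>F2\<^esub> gen_a"
  "R_gen GenB gen_a = gen_a \<otimes>\<^bsub>F2\<^esub> gen_b" "R_gen GenB gen_b = gen_b"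
  by (simp_all add: R_gen_def mult_free_group reduce_def free_lift_def free_gen_def inv_letter_def)

theorem ex1_R: "\<exists>!R. is_R R"
proof (rule ex_ex1I)
  have A: "group (AutoGroup F2)"
    by (rule group.AutoGroup[OF group_free_group])
  have ran: "range R_gen \<subseteq> carrier (AutoGroup F2)"
    using R_gen_auto by (auto simp: carrier_AutoGroup)
  let ?R = "restrict (free_lift (AutoGroup F2) R_gen) (carrier F2)"
  have "?R \<in> hom F2 (AutoGroup F2)"
    using group.free_lift_hom[OF A ran] by (auto simp: hom_def Pi_iff mult_free_group)
  moreover have "?R gen_a = R_gen GenA" "?R gen_b = R_gen GenB"
    by (simp_all add: group.free_lift_gen[OF A ran])
  ultimately have "is_R ?R"
    by (simp add: is_R_def R_gen_values)
  then show "\<exists>R. is_R R" by blast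
next
  fix R S assume R: "is_R R" and S: "is_R S"
  have A: "group (AutoGroup F2)"
    by (rule group.AutoGroup[OF group_free_group])
  have hom: "R \<in> hom F2 (AutoGroup F2)" "S \<in> hom F2 (AutoGroup F2)"
    using R S by (auto simp: is_R_def)
  have aut: "R w \<in> auto F2" "S w \<in> auto F2" if "w \<in> carrier F2" for w
    using hom that by (auto simp: hom_def carrier_AutoGroup)
  have ext: "R u = S u" if u: "u \<in> carrier F2"
    and *: "R u gen_a = S u gen_a" "R u gen_b = S u gen_b" for u
  proof
    fix w
    have "R u \<in> hom F2 F2" "S u \<in> hom F2 F2"
      and e: "R u \<in> extensional (carrier F2)" "S u \<in> extensional (carrier F2)"
      using aut[OF u] by (auto simp: auto_def Bij_def)
    then show "R u w = S u w"
      using F2_hom_eq[OF group_free_group _ _ *] extensional_arb[OF e(1)] extensional_arb[OF e(2)]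
      by (cases "w \<in> carrier F2") auto
  qed
  have gens: "R gen_a = S gen_a" "R gen_b = S gen_b"
    using R S by (auto intro!: ext simp: is_R_def)
  show "R = S"
  proof (rule extensionalityI[of R "carrier F2" S])
    show "R w = S w" if "w \<in> carrier F2" for w
      using F2_hom_eq[OF A hom gens that] .
  qed (use R S in \<open>auto simp: is_R_def\<close>)
qed

corollary is_R_R_map: "is_R R_map"
  unfolding R_map_def by (rule theI'[OF ex1_R])


section \<open>The profinite topology\<close>

text \<open>
  The initial topology for all homomorphisms to finite discrete groups.  A definition cannot range
  over all types, so the finite groups are taken with carriers in \<^typ>\<open>nat\<close>; every finite group
  is isomorphic to one of these.
\<close>

definition profinite_topology :: "('a, 'm) monoid_scheme \<Rightarrow> 'a topology" where
  "profinite_topology G = topology_generated_by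
     {h -` U \<inter> carrier G | h U (H :: nat monoid).
        group H \<and> finite (carrier H) \<and> h \<in> hom G H \<and> openin (discrete_topology (carrier H)) U}"

lemma topspace_profinite_topology [simp]: "topspace (profinite_topology G) = carrier G"
proof -
  let ?H = "\<lparr>carrier = {0}, mult = \<lambda>_ _. 0, one = 0\<rparr> :: nat monoid"
  have "group ?H" by (rule groupI) auto
  moreover have "(\<lambda>_. 0) \<in> hom G ?H" by (auto simp: hom_def)
  ultimately have "carrier G \<in> {h -` U \<inter> carrier G | h U (H :: nat monoid).
      group H \<and> finite (carrier H) \<and> h \<in> hom G H \<and> openin (discrete_topology (carrier H)) U}"
    by (intro CollectI exI[of _ "\<lambda>_. 0"] exI[of _ "{0}"] exI[of _ ?H]) auto
  then show ?thesis
    unfolding profinite_topology_def topology_generated_by_topspace by blast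
qed

theorem continuous_map_profinite_hom:
  fixes H :: "('b, 'n) monoid_scheme"
  assumes H: "group H" and fin: "finite (carrier H)" and h: "h \<in> hom G H"
  shows "continuous_map (profinite_topology G) (discrete_topology (carrier H)) h"
proof -
  obtain e :: "'b \<Rightarrow> nat" where e: "inj_on e (carrier H)"
    using finite_imp_inj_to_nat_seg[OF fin] by blast
  define d where "d = inv_into (carrier H) e"
  have d: "d (e x) = x" if "x \<in> carrier H" for x
    using e that by (simp add: d_def)
  interpret H: group H by (rule H)
  define K where
    "K = \<lparr>carrier = e ` carrier H, mult = \<lambda>x y. e (d x \<otimes>\<^bsub>H\<^esub> d y), one = e \<one>\<^bsub>H\<^esub>\<rparr>"
  have "group K"
  proof (rule groupI)
    fix x assume "x \<in> carrier K"
    then obtain y where y: "y \<in> carrier H" "x = e y" by (auto simp: K_def)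
    then show "\<exists>z\<in>carrier K. z \<otimes>\<^bsub>K\<^esub> x = \<one>\<^bsub>K\<^esub>"
      by (intro bexI[of _ "e (inv\<^bsub>H\<^esub> y)"]) (auto simp: K_def d)
  qed (auto simp: K_def d H.m_assoc)
  moreover have "finite (carrier K)"
    using fin by (simp add: K_def)
  moreover have "(\<lambda>x. e (h x)) \<in> hom G K"
    using h by (auto simp: hom_def K_def d Pi_iff)
  ultimately have K: "openin (profinite_topology G) ((\<lambda>x. e (h x)) -` V \<inter> carrier G)"
    if "V \<subseteq> carrier K" for V
    unfolding profinite_topology_def using that
    by (intro topology_generated_by_Basis CollectI exI[of _ "\<lambda>x. e (h x)"] exI[of _ V] exI[of _ K])
       auto
  have hc: "h x \<in> carrier H" if "x \<in> carrier G" for x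
    using h that by (auto simp: hom_def)
  show ?thesis
    unfolding continuous_map_def
  proof (intro conjI allI impI)
    fix U assume "openin (discrete_topology (carrier H)) U"
    then have U: "U \<subseteq> carrier H" by simp
    then have "{x \<in> carrier G. h x \<in> U} = (\<lambda>x. e (h x)) -` (e ` U) \<inter> carrier G"
      using hc inj_onD[OF e] by auto
    with K[of "e ` U"] U show "openin (profinite_topology G) {x \<in> topspace (profinite_topology G). h x \<in> U}"
      by (auto simp: K_def)
  qed (use hc in auto)
qed

theorem profinite_topology_coarsest:
  assumes top: "topspace T = carrier G"
    and cont: "\<And>h (H :: nat monoid). group H \<Longrightarrow> finite (carrier H) \<Longrightarrow> h \<in> hom G H \<Longrightarrow>
                 continuous_map T (discrete_topology (carrier H)) h"
    and U: "openin (profinite_topology G) U"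
  shows "openin T U"
proof (rule generate_topology_on_coarsest[OF istopology_openin])
  show "generate_topology_on {h -` U \<inter> carrier G | h U (H :: nat monoid).
      group H \<and> finite (carrier H) \<and> h \<in> hom G H \<and> openin (discrete_topology (carrier H)) U} U"
    using U unfolding profinite_topology_def by (rule openin_topology_generated_by)
next
  fix S
  assume "S \<in> {h -` U \<inter> carrier G | h U (H :: nat monoid).
      group H \<and> finite (carrier H) \<and> h \<in> hom G H \<and> openin (discrete_topology (carrier H)) U}"
  then obtain h V and H :: "nat monoid" where
    S: "S = h -` V \<inter> carrier G" and H: "group H" "finite (carrier H)" "h \<in> hom G H"
    and V: "openin (discrete_topology (carrier H)) V" by blast
  have "S = {x \<in> topspace T. h x \<in> V}" using S top by auto
  then show "openin T S"
    using openin_continuous_map_preimage[OF cont[OF H] V] by simp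
qed

end

theory Submission
  imports Defs
begin

text \<open>
  Let \<open>h\<close> be a homomorphism from \<open>F2\<close> to a finite group \<open>H\<close>.  By freeness the homomorphisms from
  \<open>F2\<close> to \<open>H\<close> correspond to the points of the finite set \<open>H \<times> H\<close>, and \<open>F2\<close> acts on them from the
  right by precomposition with \<open>R\<close>.  Since \<open>h (Pal w) = h (b\<inverse> a\<inverse>) (h \<circ> R w) (a b)\<close>,
  the value \<open>h (Pal w)\<close> depends only on the permutation of \<open>H \<times> H\<close> induced by \<open>w\<close>, that is, on
  the image of \<open>w\<close> in a finite group.
\<close>

text \<open>The preimages of sets under homomorphisms to finite groups form a subbasis of the target
  topology, and pulling such a set back along \<open>f\<close> gives a preimage under
  \<open>h \<circ> f\<close>.\<close>

lemma continuous_map_into_profinite: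
  assumes f: "\<And>x. x \<in> topspace T \<Longrightarrow> f x \<in> carrier G"
    and cont: "\<And>h (H :: nat monoid). group H \<Longrightarrow> finite (carrier H) \<Longrightarrow> h \<in> hom G H \<Longrightarrow>
                 continuous_map T (discrete_topology (carrier H)) (\<lambda>x. h (f x))"
  shows "continuous_map T (profinite_topology G) f"
proof -
  have top: "topspace (profinite_topology G) = carrier G" by simp
  show ?thesis
    unfolding profinite_topology_def
  proof (rule continuous_on_generated_topo)
    fix S
    assume "S \<in> {h -` U \<inter> carrier G | h U (H :: nat monoid).
        group H \<and> finite (carrier H) \<and> h \<in> hom G H \<and> openin (discrete_topology (carrier H)) U}"
    then obtain h U and H :: "nat monoid" where S: "S = h -` U \<inter> carrier G"
      and H: "group H" "finite (carrier H)" "h \<in> hom G H"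
      and U: "openin (discrete_topology (carrier H)) U" by blast
    have "f -` S \<inter> topspace T = {x \<in> topspace T. h (f x) \<in> U}"
      using S f by auto
    then show "openin T (f -` S \<inter> topspace T)"
      using openin_continuous_map_preimage[OF cont[OF H] U] by simp
  next
    show "f ` topspace T \<subseteq> \<Union> {h -` U \<inter> carrier G | h U (H :: nat monoid).
        group H \<and> finite (carrier H) \<and> h \<in> hom G H \<and> openin (discrete_topology (carrier H)) U}"
      using f top unfolding profinite_topology_def topology_generated_by_topspace by blast
  qed
qed

text \<open>Members of \<open>Bij X\<close> are extensional, so they lie among the finitely many
  extensional maps from \<open>X\<close> to itself.\<close>

lemma finite_BijGroup:
  assumes "finite X"
  shows "finite (carrier (BijGroup X))"
proof (rule finite_subset)
  show "carrier (BijGroup X) \<subseteq> (\<Pi>\<^sub>E x\<in>X. X)"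
    by (auto simp: BijGroup_def Bij_def PiE_def bij_betw_def)
  show "finite (\<Pi>\<^sub>E x\<in>X. X)"
    using assms by (intro finite_PiE)
qed

text \<open>The inverse of \<open>g\<close> acts as a two-sided inverse of \<open>\<phi> g\<close>
  on \<open>X\<close>, so each map is a bijection. Restricting to \<open>X\<close> supplies the
  extensionality that \<open>Bij\<close> demands.\<close>

lemma hom_BijGroup_of_action:
  assumes G: "group G"
    and closed: "\<And>g x. g \<in> carrier G \<Longrightarrow> x \<in> X \<Longrightarrow> \<phi> g x \<in> X"
    and one: "\<And>x. x \<in> X \<Longrightarrow> \<phi> \<one>\<^bsub>G\<^esub> x = x"
    and mult: "\<And>g k x. g \<in> carrier G \<Longrightarrow> k \<in> carrier G \<Longrightarrow> x \<in> X \<Longrightarrow>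
                 \<phi> (g \<otimes>\<^bsub>G\<^esub> k) x = \<phi> g (\<phi> k x)"
  shows "(\<lambda>g. restrict (\<phi> g) X) \<in> hom G (BijGroup X)"
proof -
  interpret G: group G by (rule G)
  have bij: "restrict (\<phi> g) X \<in> Bij X" if g: "g \<in> carrier G" for g
  proof -
    have "\<phi> (inv\<^bsub>G\<^esub> g) (\<phi> g x) = x" "\<phi> g (\<phi> (inv\<^bsub>G\<^esub> g) x) = x" if "x \<in> X" for x
      using that g by (simp_all add: one flip: mult)
    then have "bij_betw (restrict (\<phi> g) X) X X"
      using closed g by (intro bij_betw_byWitness[where f' = "\<phi> (inv\<^bsub>G\<^esub> g)"]) auto
    then show ?thesis by (simp add: Bij_def)
  qed
  show ?thesis
  proof (rule homI)
    fix g k assume "g \<in> carrier G" "k \<in> carrier G"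
    then show "restrict (\<phi> (g \<otimes>\<^bsub>G\<^esub> k)) X =
        restrict (\<phi> g) X \<otimes>\<^bsub>BijGroup X\<^esub> restrict (\<phi> k) X"
      using closed by (auto simp: BijGroup_def bij compose_def mult fun_eq_iff)
  qed (simp add: BijGroup_def bij)
qed

lemma R_map_auto: "w \<in> carrier F2 \<Longrightarrow> R_map w \<in> auto F2"
  using is_R_R_map by (auto simp: is_R_def hom_def carrier_AutoGroup)

lemma R_map_hom: "w \<in> carrier F2 \<Longrightarrow> R_map w \<in> hom F2 F2"
  using R_map_auto by (auto simp: auto_def)

lemma R_map_closed: "w \<in> carrier F2 \<Longrightarrow> v \<in> carrier F2 \<Longrightarrow> R_map w v \<in> carrier F2"
  using hom_in_carrier[OF R_map_hom] by blast

lemma R_map_mult: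
  assumes "u \<in> carrier F2" "v \<in> carrier F2" "x \<in> carrier F2"
  shows "R_map (u \<otimes>\<^bsub>F2\<^esub> v) x = R_map u (R_map v x)"
proof -
  have "R_map (u \<otimes>\<^bsub>F2\<^esub> v) = R_map u \<otimes>\<^bsub>AutoGroup F2\<^esub> R_map v"
    using is_R_R_map assms unfolding is_R_def by (intro hom_mult) auto
  also have "\<dots> = compose (carrier F2) (R_map u) (R_map v)"
    using R_map_auto[of u] R_map_auto[of v] assms
    by (simp add: AutoGroup_def BijGroup_def auto_def)
  finally show ?thesis using assms by (simp add: compose_def)
qed

text \<open>The identity is its own square, so its image under \<open>R_map\<close> is idempotent;
  an injective idempotent map is the identity.\<close>

lemma R_map_one:
  assumes "x \<in> carrier F2"
  shows "R_map \<one>\<^bsub>F2\<^esub> x = x"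
proof -
  have one: "\<one>\<^bsub>F2\<^esub> \<in> carrier F2" by simp
  have "R_map \<one>\<^bsub>F2\<^esub> (R_map \<one>\<^bsub>F2\<^esub> x) = R_map \<one>\<^bsub>F2\<^esub> x"
    using R_map_mult[OF one one assms] by (simp add: mult_free_group reduce_def)
  moreover have "inj_on (R_map \<one>\<^bsub>F2\<^esub>) (carrier F2)"
    using R_map_auto[OF one] by (auto simp: auto_def Bij_def bij_betw_def)
  ultimately show ?thesis
    using R_map_closed[OF one assms] assms by (auto dest: inj_onD)
qed

lemma Pal_closed: "w \<in> carrier F2 \<Longrightarrow> Pal w \<in> carrier F2"
  unfolding Pal_def
  by (intro monoid.m_closed group.inv_closed group.is_monoid group_free_group R_map_closed) auto

context group
begin

text \<open>On pairs from \<open>carrier G\<close> this is the bijection with the homomorphisms from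
  \<open>F2\<close> to \<open>G\<close>; its inverse evaluates at the two generators.\<close>

definition hom_of_pair :: "'a \<times> 'a \<Rightarrow> F2_word \<Rightarrow> 'a" where
  "hom_of_pair p = free_lift G (case_F2_gen (fst p) (snd p))"

text \<open>This is precomposition of homomorphisms with \<open>R_map w\<close>, transported to
  pairs.\<close>

definition pair_act :: "'a \<times> 'a \<Rightarrow> F2_word \<Rightarrow> 'a \<times> 'a" where
  "pair_act p w = (hom_of_pair p (R_map w gen_a), hom_of_pair p (R_map w gen_b))"

lemma range_pair: "p \<in> carrier G \<times> carrier G \<Longrightarrow> range (case_F2_gen (fst p) (snd p)) \<subseteq> carrier G"
  using range_F2_gen[of "fst p" "snd p"] by auto

lemma hom_of_pair_hom: "p \<in> carrier G \<times> carrier G \<Longrightarrow> hom_of_pair p \<in> hom F2 G"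
  unfolding hom_of_pair_def by (intro free_lift_hom range_pair)

lemma hom_of_pair_closed:
  "p \<in> carrier G \<times> carrier G \<Longrightarrow> hom_of_pair p w \<in> carrier G"
  unfolding hom_of_pair_def by (intro free_lift_closed range_pair)

lemma hom_of_pair_gen:
  assumes "p \<in> carrier G \<times> carrier G"
  shows "hom_of_pair p gen_a = fst p" "hom_of_pair p gen_b = snd p"
  unfolding hom_of_pair_def by (simp_all add: free_lift_gen[OF range_pair[OF assms]])

text \<open>This is the uniqueness half of freeness: both sides are homomorphisms that agree on the
  generators.\<close>

lemma hom_of_pair_eq:
  assumes h: "h \<in> hom F2 G" and w: "w \<in> carrier F2"
  shows "hom_of_pair (h gen_a, h gen_b) w = h w"
proof -
  have p: "(h gen_a, h gen_b) \<in> carrier G \<times> carrier G"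
    using h by (auto simp: hom_def Pi_iff)
  show ?thesis
    by (rule F2_hom_eq[OF is_group hom_of_pair_hom[OF p] h _ _ w])
       (simp_all add: hom_of_pair_gen[OF p])
qed

lemma pair_act_closed:
  "p \<in> carrier G \<times> carrier G \<Longrightarrow> pair_act p w \<in> carrier G \<times> carrier G"
  by (auto simp: pair_act_def intro: hom_of_pair_closed)

text \<open>The left side is a homomorphism in \<open>x\<close>, and the coordinates of
  \<open>pair_act p w\<close> are by definition its values on the generators.\<close>

lemma hom_of_pair_R_map:
  assumes p: "p \<in> carrier G \<times> carrier G" and w: "w \<in> carrier F2" and x: "x \<in> carrier F2"
  shows "hom_of_pair p (R_map w x) = hom_of_pair (pair_act p w) x"
proof -
  have "(\<lambda>x. hom_of_pair p (R_map w x)) \<in> hom F2 G"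
    using R_map_hom[OF w] hom_of_pair_hom[OF p] by (auto simp: hom_def Pi_iff)
  from hom_of_pair_eq[OF this x] show ?thesis by (simp add: pair_act_def)
qed

lemma pair_act_one:
  assumes "p \<in> carrier G \<times> carrier G"
  shows "pair_act p \<one>\<^bsub>F2\<^esub> = p"
  using R_map_one[of gen_a] R_map_one[of gen_b]
  by (simp add: pair_act_def hom_of_pair_gen[OF assms])

text \<open>The action is a right one because \<open>R_map\<close> sends a product to the composite
  that applies the right factor first: with \<open>k = hom_of_pair p\<close>, precomposition gives
  \<open>k \<circ> (R_map u \<circ> R_map v) = (k \<circ> R_map u) \<circ> R_map v\<close>.\<close>

lemma pair_act_mult:
  assumes "p \<in> carrier G \<times> carrier G" "u \<in> carrier F2" "v \<in> carrier F2"
  shows "pair_act p (u \<otimes>\<^bsub>F2\<^esub> v) = pair_act (pair_act p u) v"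
  using assms R_map_closed[of v]
  by (simp add: pair_act_def[of p "u \<otimes>\<^bsub>F2\<^esub> v"] pair_act_def[of "pair_act p u" v]
        R_map_mult hom_of_pair_R_map)

text \<open>On \<open>F2\<close> the map factors as \<open>g \<circ> \<sigma>\<close> with
  \<open>\<sigma>\<close> a homomorphism to a finite group. Here \<open>g\<close> is a mere
  function, and every function on a discrete space is continuous.\<close>

lemma hom_Pal_continuous:
  assumes fin: "finite (carrier G)" and h: "h \<in> hom F2 G"
  shows "continuous_map (profinite_topology F2) (discrete_topology (carrier G)) (\<lambda>w. h (Pal w))"
proof -
  interpret F: group F2 by (rule group_free_group)
  define X where "X = carrier G \<times> carrier G"
  define p where "p = (h gen_a, h gen_b)"
  define \<sigma> where "\<sigma> w = restrict (\<lambda>q. pair_act q (inv\<^bsub>F2\<^esub> w)) X" for w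
  define c where "c = h (inv\<^bsub>F2\<^esub> gen_b \<otimes>\<^bsub>F2\<^esub> inv\<^bsub>F2\<^esub> gen_a)"
  \<comment> \<open>Since \<open>\<sigma> w\<close> acts through the inverse of \<open>w\<close>, it
    sends \<open>pair_act p w\<close> to \<open>p\<close>. The preimage of \<open>p\<close> thus
    recovers \<open>pair_act p w\<close> from the permutation alone.\<close>
  define g where "g f = c \<otimes> hom_of_pair (inv_into X f p) (gen_a \<otimes>\<^bsub>F2\<^esub> gen_b)" for f
  have p: "p \<in> X"
    using h by (auto simp: p_def X_def hom_def Pi_iff)
  \<comment> \<open>Inverting \<open>w\<close> turns the right action into a left one.\<close>
  have \<sigma>: "\<sigma> \<in> hom F2 (BijGroup X)"
    unfolding \<sigma>_def
  proof (rule hom_BijGroup_of_action[OF group_free_group])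
    fix u v q assume u: "u \<in> carrier F2" and v: "v \<in> carrier F2" and "q \<in> X"
    then show "pair_act q (inv\<^bsub>F2\<^esub> (u \<otimes>\<^bsub>F2\<^esub> v)) = pair_act (pair_act q (inv\<^bsub>F2\<^esub> v)) (inv\<^bsub>F2\<^esub> u)"
      unfolding X_def F.inv_mult_group[OF u v] by (intro pair_act_mult F.inv_closed)
  next
    fix q assume "q \<in> X"
    then show "pair_act q (inv\<^bsub>F2\<^esub> \<one>\<^bsub>F2\<^esub>) = q"
      unfolding X_def F.inv_one by (rule pair_act_one)
  qed (unfold X_def, rule pair_act_closed)
  have eq: "h (Pal w) = g (\<sigma> w)" if w: "w \<in> carrier F2" for w
  proof -
    have ab: "gen_a \<otimes>\<^bsub>F2\<^esub> gen_b \<in> carrier F2"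
      by (intro F.m_closed) auto
    have "inj_on (\<sigma> w) X"
      using hom_in_carrier[OF \<sigma> w] by (simp add: BijGroup_def Bij_def bij_betw_def)
    \<comment> \<open>Acting by \<open>w\<close> and then by its inverse is acting by the
      identity.\<close>
    moreover have "\<sigma> w (pair_act p w) = p"
      using p w pair_act_closed[of p w] pair_act_mult[of p w "inv\<^bsub>F2\<^esub> w"] F.inv_closed[OF w]
        F.r_inv[OF w] pair_act_one[of p]
      by (simp add: \<sigma>_def X_def)
    ultimately have "inv_into X (\<sigma> w) p = pair_act p w"
      using p pair_act_closed[of p w] by (intro inv_into_f_eq) (auto simp: X_def)
    moreover have "h (R_map w (gen_a \<otimes>\<^bsub>F2\<^esub> gen_b)) = hom_of_pair (pair_act p w) (gen_a \<otimes>\<^bsub>F2\<^esub> gen_b)"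
      using hom_of_pair_eq[OF h R_map_closed[OF w ab]] hom_of_pair_R_map[OF _ w ab, of p] p
      by (simp add: p_def X_def)
    moreover have "h (Pal w) = c \<otimes> h (R_map w (gen_a \<otimes>\<^bsub>F2\<^esub> gen_b))"
      unfolding Pal_def c_def using R_map_closed[OF w ab]
      by (intro hom_mult[OF h] F.m_closed F.inv_closed) auto
    ultimately show ?thesis by (simp add: g_def)
  qed
  let ?B = "discrete_topology (carrier (BijGroup X))"
  have \<sigma>_cont: "continuous_map (profinite_topology F2) ?B \<sigma>"
    using fin by (intro continuous_map_profinite_hom group_BijGroup finite_BijGroup \<sigma>)
                 (simp add: X_def)
  \<comment> \<open>By \<open>eq\<close>, membership is a condition on \<open>\<sigma> w\<close>
    alone, and every set of permutations is open in \<open>?B\<close>, so \<open>U\<close> can be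
    arbitrary.\<close>
  have "openin (profinite_topology F2) {w \<in> carrier F2. h (Pal w) \<in> U}" for U
  proof -
    have "{w \<in> carrier F2. h (Pal w) \<in> U} =
        {w \<in> topspace (profinite_topology F2). \<sigma> w \<in> {f \<in> carrier (BijGroup X). g f \<in> U}}"
      using eq hom_in_carrier[OF \<sigma>] by auto
    also have "openin (profinite_topology F2) \<dots>"
      by (rule openin_continuous_map_preimage[OF \<sigma>_cont]) auto
    finally show ?thesis .
  qed
  then show ?thesis
    using hom_in_carrier[OF h] Pal_closed by (auto simp: continuous_map_def)
qed

end

theorem theorem6p1:
  shows "continuous_map (profinite_topology F2) (profinite_topology F2) Pal"
proof (rule continuous_map_into_profinite)
  show "Pal w \<in> carrier F2" if "w \<in> topspace (profinite_topology F2)" for w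
    using that Pal_closed by simp
qed (rule group.hom_Pal_continuous)

end
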